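(* Let $(\ell_i)_{i\ge1}$ be a sequence of sets of integers with $|\ell_i|=4$ for all $i$, and for each $n$ let $T_n$ be the set of square-free words $w=w_1\cdots w_n$ of length $n$ such that $w_i\in\ell_i$ for all $i\in\{1,\dots,n\}$. Then for all $n\ge1$, $$|T_n|\ge 2.45^n.$$
   Context: A square is a word of the form $uu$ with $u$ a non-empty word; a word is square-free if none of its factors is a square. *)

theory Defs
  imports Complex_Main "HOL-Library.Sublist"
begin

definition square :: "'a list \<Rightarrow> bool" where
  "square w \<longleftrightarrow> (\<exists>u. u \<noteq> [] \<and> w = u @ u)"

text \<open>Factors are contiguous subwords, i.e. \<^const>\<open>sublist\<close> from the library.\<close>

definition square_free :: "'a list \<Rightarrow> bool" where
  "square_free w \<longleftrightarrow> (\<forall>v. sublist v w \<longrightarrow> \<not> square v)"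

text \<open>The letter \<open>w\<^sub>i\<close> of the mathematical notation, counted from 1, is \<open>w ! (i - 1)\<close>.\<close>

definition T :: "(nat \<Rightarrow> 'a set) \<Rightarrow> nat \<Rightarrow> 'a list set" where
  "T l n = {w. length w = n \<and> square_free w \<and> (\<forall>i\<in>{1..n}. w ! (i - 1) \<in> l i)}"

end

theory Submission
  imports Defs
begin

text \<open>
  Give a word weight \<open>0.732\<close> if it ends in a factor \<open>aba\<close> and weight \<open>1\<close> otherwise, and let
  \<open>W n\<close> be the total weight of \<open>T l n\<close>. Avoiding only squares of period 1 and 2, the one-letter
  extensions of a word have at least \<open>2.732\<close> times its weight: a word ending in \<open>aba\<close> has two
  extensions of weight 1, as \<open>2 \<ge> 2.732 * 0.732\<close>, and any other word has three extensions, at most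
  one of which ends in \<open>aba\<close>. An extension that creates a square \<open>uu\<close> with \<open>|u| = p \<ge> 3\<close> is
  determined by what remains after deleting the last \<open>u\<close>, and this deletion preserves the last
  three letters, hence the weight. So
  \<open>W (n + 1) \<ge> 2.732 * W n - (\<Sum>p\<ge>3. W (n + 1 - p))\<close>, and \<open>W (n + 1) \<ge> 2.45 * W n\<close>
  follows by induction, because \<open>2.732 - (\<Sum>p\<ge>3. 2.45 powi (1 - p)) > 2.45\<close>.
\<close>

section \<open>Square-free words and their prefixes\<close>

lemma square_free_snoc:
  "square_free (w @ [a]) \<longleftrightarrow> square_free w \<and> (\<forall>u. u \<noteq> [] \<longrightarrow> \<not> suffix (u @ u) (w @ [a]))"
  unfolding square_free_def square_def sublist_snoc by blast

lemma square_free_sublist: "square_free w \<Longrightarrow> sublist v w \<Longrightarrow> square_free v"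
  unfolding square_free_def by (meson sublist_order.order.trans)

lemma T_0: "T l 0 = {[]}"
  by (auto simp: T_def square_free_def square_def)

lemma snoc_in_T_Suc:
  "w @ [a] \<in> T l (Suc n) \<longleftrightarrow>
    w \<in> T l n \<and> a \<in> l (Suc n) \<and> (\<forall>u. u \<noteq> [] \<longrightarrow> \<not> suffix (u @ u) (w @ [a]))"
proof -
  have "(\<forall>i\<in>{1..Suc n}. (w @ [a]) ! (i - 1) \<in> l i) \<longleftrightarrow>
      (\<forall>i\<in>{1..n}. w ! (i - 1) \<in> l i) \<and> a \<in> l (Suc n)" if "length w = n"
  proof -
    have "{1..Suc n} = insert (Suc n) {1..n}" by auto
    moreover have "(w @ [a]) ! (i - 1) = w ! (i - 1)" if "i \<in> {1..n}" for i
      using that \<open>length w = n\<close> by (auto simp: nth_append)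
    ultimately show ?thesis using that by auto
  qed
  then show ?thesis by (auto simp: T_def square_free_snoc)
qed

lemma take_in_T: "w \<in> T l n \<Longrightarrow> m \<le> n \<Longrightarrow> take m w \<in> T l m"
  by (auto simp: T_def intro: square_free_sublist)

lemma finite_T:
  assumes "\<And>i. i \<ge> 1 \<Longrightarrow> finite (l i)"
  shows "finite (T l n)"
proof (rule finite_subset)
  show "T l n \<subseteq> {w. set w \<subseteq> (\<Union>i\<in>{1..n}. l i) \<and> length w = n}"
    by (force simp: T_def in_set_conv_nth)
  show "finite {w. set w \<subseteq> (\<Union>i\<in>{1..n}. l i) \<and> length w = n}"
    by (rule finite_lists_length_eq) (use assms in auto)
qed

section \<open>Weights and extensions avoiding squares of period 1 and 2\<close>

definition ends_aba :: "'a list \<Rightarrow> bool" where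
  "ends_aba w \<longleftrightarrow> (\<exists>a b. suffix [a, b, a] w)"

text \<open>\<open>0.732\<close> is \<open>sqrt 3 - 1\<close> rounded down: with weight x on words
  ending in \<open>aba\<close>, the two guaranteed growth factors are 2 / x and 2 + x, and they
  agree for x = sqrt 3 - 1.\<close>

definition weight :: "'a list \<Rightarrow> real" where
  "weight w = (if ends_aba w then 0.732 else 1)"

definition short_square_free_ext :: "'a list \<Rightarrow> 'a \<Rightarrow> bool" where
  "short_square_free_ext w a \<longleftrightarrow> (\<forall>u. u \<noteq> [] \<and> length u \<le> 2 \<longrightarrow> \<not> suffix (u @ u) (w @ [a]))"

lemma weight_nonneg: "weight w \<ge> 0"
  and weight_le_1: "weight w \<le> 1"
  by (auto simp: weight_def)

text \<open>Deleting the final \<open>a\<close> from the squares \<open>aa\<close> and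
  \<open>baba\<close> leaves \<open>a\<close> and \<open>bab\<close>.\<close>

lemma short_square_free_ext_iff:
  "short_square_free_ext w a \<longleftrightarrow> \<not> suffix [a] w \<and> (\<forall>b. \<not> suffix [b, a, b] w)"
proof -
  have "(\<exists>u. u \<noteq> [] \<and> length u \<le> 2 \<and> suffix (u @ u) (w @ [a])) \<longleftrightarrow>
      suffix [a] w \<or> (\<exists>b. suffix [b, a, b] w)"
  proof
    assume "\<exists>u. u \<noteq> [] \<and> length u \<le> 2 \<and> suffix (u @ u) (w @ [a])"
    then obtain u where u: "u \<noteq> []" "length u \<le> 2" "suffix (u @ u) (w @ [a])" by blast
    then consider x where "u = [x]" | x y where "u = [x, y]"
      by (cases u; cases "tl u"; auto)
    then show "suffix [a] w \<or> (\<exists>b. suffix [b, a, b] w)"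
    proof cases
      case 1
      then show ?thesis using u(3) by (auto simp: suffix_def)
    next
      case 2
      then obtain v where "w @ [a] = v @ [x, y, x, y]" using u(3) by (auto simp: suffix_def)
      then have "w @ [a] = (v @ [x, y, x]) @ [y]" by simp
      then have "w = v @ [x, y, x]" "a = y" by (simp_all only: append1_eq_conv)
      then show ?thesis by (auto simp: suffix_def)
    qed
  next
    assume "suffix [a] w \<or> (\<exists>b. suffix [b, a, b] w)"
    then show "\<exists>u. u \<noteq> [] \<and> length u \<le> 2 \<and> suffix (u @ u) (w @ [a])"
    proof (elim disjE exE)
      assume "suffix [a] w"
      then show ?thesis by (intro exI[of _ "[a]"]) (auto simp: suffix_def)
    next
      fix b assume "suffix [b, a, b] w"
      then show ?thesis by (intro exI[of _ "[b, a]"]) (auto simp: suffix_def)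
    qed
  qed
  then show ?thesis unfolding short_square_free_ext_def by blast
qed

lemma ends_aba_snoc: "ends_aba (w @ [c]) \<longleftrightarrow> (\<exists>b. suffix [c, b] w)"
proof -
  have "suffix [x, y, x] (w @ [c]) \<longleftrightarrow> x = c \<and> suffix [x, y] w" for x y
    using snoc_suffix_snoc[of "[x, y]" x w c] by simp
  then show ?thesis by (auto simp: ends_aba_def)
qed

lemma weight_extensions:
  assumes w: "square_free w" and L: "card L = 4"
  shows "2.732 * weight w \<le> (\<Sum>a | a \<in> L \<and> short_square_free_ext w a. weight (w @ [a]))"
proof -
  have fin: "finite L" using L by (intro card_ge_0_finite) simp
  \<comment> \<open>As weights are nonnegative, it suffices to enclose the forbidden letters in a
    set \<open>D\<close> and to sum over the rest of \<open>L\<close>.\<close>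
  have mono: "(\<Sum>c\<in>L - D. weight (w @ [c]))
      \<le> (\<Sum>a | a \<in> L \<and> short_square_free_ext w a. weight (w @ [a]))"
    if "\<And>c. c \<notin> D \<Longrightarrow> short_square_free_ext w c" for D
    by (rule sum_mono2) (use fin that weight_nonneg in auto)
  show ?thesis
  proof (cases "ends_aba w")
    case True
    then obtain a b v where v: "w = v @ [a, b, a]" by (auto simp: ends_aba_def suffix_def)
    have suf: "suffix [x, y] w \<longleftrightarrow> x = b \<and> y = a" "suffix [x] w \<longleftrightarrow> x = a"
      "suffix [x, y, x] w \<longleftrightarrow> x = a \<and> y = b" for x y
      by (auto simp: v suffix_def)
    have ok: "short_square_free_ext w c" if "c \<notin> {a, b}" for c
      using that by (auto simp: short_square_free_ext_iff suf)
    have "card (L - {a, b}) \<ge> card L - card {a, b}" by (rule diff_card_le_card_Diff) simp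
    moreover have "card {a, b} \<le> 2" by (simp add: card_insert_if)
    ultimately have "card (L - {a, b}) \<ge> 2" using L by linarith
    \<comment> \<open>Only \<open>b\<close> would create an ending \<open>xyx\<close>, namely
      \<open>bab\<close>, and it is excluded; so each remaining extension has weight 1.\<close>
    moreover have "(\<Sum>c\<in>L - {a, b}. weight (w @ [c])) = (\<Sum>c\<in>L - {a, b}. 1)"
      by (rule sum.cong) (auto simp: weight_def ends_aba_snoc suf)
    ultimately have "2 \<le> (\<Sum>c\<in>L - {a, b}. weight (w @ [c]))" by simp
    then show ?thesis using mono[of "{a, b}"] ok True by (simp add: weight_def)
  next
    case False
    \<comment> \<open>\<open>b\<close> is the last letter of \<open>w\<close> and \<open>a\<close>
      the one before it; a letter that a short \<open>w\<close> lacks is arbitrary.\<close>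
    have "\<exists>a b. \<forall>c. (c \<noteq> b \<longrightarrow> \<not> suffix [c] w) \<and> (c \<noteq> a \<longrightarrow> (\<forall>d. \<not> suffix [c, d] w))"
    proof (cases w rule: rev_cases)
      case Nil
      then show ?thesis by simp
    next
      case (snoc v b)
      note w_eq = this
      show ?thesis
      proof (cases v rule: rev_cases)
        case Nil
        then show ?thesis using w_eq by (auto simp: suffix_def Cons_eq_append_conv)
      next
        case (snoc v' a)
        then show ?thesis using w_eq by (intro exI[of _ a] exI[of _ b]) (auto simp: suffix_def)
      qed
    qed
    then obtain a b where ab: "\<And>c. c \<noteq> b \<Longrightarrow> \<not> suffix [c] w"
      "\<And>c d. c \<noteq> a \<Longrightarrow> \<not> suffix [c, d] w" by blast
    have ok: "short_square_free_ext w c" if "c \<notin> {b}" for c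
      using that False ab by (auto simp: short_square_free_ext_iff ends_aba_def)
    have "card (L - {b}) \<ge> 3" using L fin by (simp add: card_Diff_singleton_if)
    \<comment> \<open>Only \<open>c = a\<close> can make \<open>w @ [c]\<close> end in
      \<open>aba\<close>; this costs \<open>1 - 0.732 = 0.268\<close>, and
      \<open>3 - 0.268 = 2.732\<close>.\<close>
    moreover have "(\<Sum>c\<in>L - {b}. 1 - (if c = a then 0.268 else 0))
        = real (card (L - {b})) - (if a \<in> L - {b} then 0.268 else 0)"
      using fin by (simp add: sum_subtractf)
    ultimately have "2.732 \<le> (\<Sum>c\<in>L - {b}. 1 - (if c = a then 0.268 else 0 :: real))"
      by (auto split: if_splits)
    also have "\<dots> \<le> (\<Sum>c\<in>L - {b}. weight (w @ [c]))"
      by (rule sum_mono) (use ab in \<open>auto simp: weight_def ends_aba_snoc\<close>)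
    also have "\<dots> \<le> (\<Sum>a | a \<in> L \<and> short_square_free_ext w a. weight (w @ [a]))"
      by (rule mono) (rule ok)
    finally show ?thesis using False by (simp add: weight_def)
  qed
qed

section \<open>Words ending in a square of period at least 3\<close>

lemma ends_aba_append:
  assumes "length u \<ge> 3"
  shows "ends_aba (v @ u) \<longleftrightarrow> ends_aba u"
proof -
  have "suffix [a, b, a] (v @ u) \<longleftrightarrow> suffix [a, b, a] u" for a b
    using assms by (auto intro: suffix_appendI dest: suffix_length_suffix[of _ "v @ u" u])
  then show ?thesis by (simp add: ends_aba_def)
qed

lemma weight_append_square:
  assumes "length u \<ge> 3"
  shows "weight (v @ u @ u) = weight (v @ u)"
  using ends_aba_append[OF assms, of v] ends_aba_append[OF assms, of "v @ u"]
  by (simp add: weight_def)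

lemma sum_weight_squares:
  assumes fin: "finite (T l (Suc n - p))" and p: "p \<ge> 3" "p \<le> n"
    and X: "\<And>x. x \<in> X \<Longrightarrow> \<exists>w\<in>T l n. \<exists>a. x = w @ [a]"
      "\<And>x. x \<in> X \<Longrightarrow> \<exists>u. length u = p \<and> suffix (u @ u) x"
  shows "sum weight X \<le> sum weight (T l (Suc n - p))"
proof -
  let ?f = "take (Suc n - p)"
  have len: "length x = Suc n" if "x \<in> X" for x using X(1)[OF that] by (auto simp: T_def)
  have dec: "\<exists>u v. length u = p \<and> x = v @ u @ u \<and> ?f x = v @ u" if "x \<in> X" for x
  proof -
    from X(2)[OF that] obtain u v where uv: "length u = p" "x = v @ u @ u"
      by (auto simp: suffix_def)
    moreover have "Suc n - p = length (v @ u)" using len[OF that] uv by simp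
    ultimately show ?thesis by auto
  qed
  \<comment> \<open>The last \<open>p\<close> letters of \<open>v @ u\<close> are \<open>u\<close>,
    so for a fixed period this prefix determines \<open>v @ u @ u\<close>.\<close>
  have inj: "inj_on ?f X"
  proof (rule inj_onI)
    fix x y assume "x \<in> X" "y \<in> X" and eq: "?f x = ?f y"
    with dec obtain u v u' v' where "length u = p" "x = v @ u @ u" "?f x = v @ u"
      "length u' = p" "y = v' @ u' @ u'" "?f y = v' @ u'" by metis
    then show "x = y" using eq by auto
  qed
  \<comment> \<open>A word of \<open>X\<close> contains a square, but the deletion removes at least
    its last letter and so leaves a prefix of a square-free \<open>w\<close>.\<close>
  have sub: "?f ` X \<subseteq> T l (Suc n - p)"
  proof
    fix y assume "y \<in> ?f ` X"
    then obtain w a where wa: "w \<in> T l n" "y = ?f (w @ [a])" using X(1) by blast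
    moreover have "length w = n" using wa by (simp add: T_def)
    ultimately have "y = ?f w" using p by simp
    then show "y \<in> T l (Suc n - p)" using take_in_T[OF wa(1)] p by simp
  qed
  have "sum weight X = (\<Sum>x\<in>X. weight (?f x))"
  proof (rule sum.cong)
    fix x assume "x \<in> X"
    then show "weight x = weight (?f x)" using dec[of x] p weight_append_square by metis
  qed simp
  also have "\<dots> = sum weight (?f ` X)" using inj by (simp add: sum.reindex)
  also have "\<dots> \<le> sum weight (T l (Suc n - p))"
    by (rule sum_mono2) (use fin sub weight_nonneg in auto)
  finally show ?thesis .
qed

section \<open>The recurrence for total weights and its growth rate\<close>

lemma sum_UNION_le:
  fixes f :: "'a \<Rightarrow> real"
  assumes "finite I" "\<And>i. i \<in> I \<Longrightarrow> finite (A i)" "\<And>x. f x \<ge> 0"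
  shows "sum f (\<Union>i\<in>I. A i) \<le> (\<Sum>i\<in>I. sum f (A i))"
  using assms(1,2)
proof (induction I rule: finite_induct)
  case (insert i I)
  have "sum f (A i \<union> (\<Union>i\<in>I. A i)) \<le> sum f (A i) + sum f (\<Union>i\<in>I. A i)"
    using insert by (simp add: sum_Un sum_nonneg assms(3))
  then show ?case using insert by simp
qed simp

text \<open>Each extension without a short square at its end is square-free or lies in some
  \<open>?B p\<close>; counting a word in several \<open>?B p\<close> repeatedly only weakens the
  bound.\<close>

lemma weight_recurrence:
  assumes l: "\<And>i. i \<ge> 1 \<Longrightarrow> card (l i) = 4"
  shows "2.732 * sum weight (T l n)
    \<le> sum weight (T l (Suc n)) + (\<Sum>p=3..n. sum weight (T l (Suc n - p)))"
proof -
  have finl: "finite (l i)" if "i \<ge> 1" for i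
    using l[OF that] by (intro card_ge_0_finite) simp
  have fin: "finite (T l m)" for m by (rule finite_T) (rule finl)
  let ?S = "SIGMA w : T l n. {a. a \<in> l (Suc n) \<and> short_square_free_ext w a}"
  let ?E = "(\<lambda>(w, a). w @ [a]) ` ?S"
  let ?B = "\<lambda>p. {x \<in> ?E. \<exists>u. length u = p \<and> suffix (u @ u) x}"
  have finS: "finite ?S" by (rule finite_SigmaI) (use fin finl in auto)
  then have finE: "finite ?E" by simp
  have "2.732 * sum weight (T l n) = (\<Sum>w\<in>T l n. 2.732 * weight w)"
    by (simp add: sum_distrib_left)
  also have "\<dots> \<le> (\<Sum>w\<in>T l n. \<Sum>a | a \<in> l (Suc n) \<and> short_square_free_ext w a. weight (w @ [a]))"
    by (rule sum_mono, rule weight_extensions) (use l in \<open>auto simp: T_def\<close>)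
  also have "\<dots> = (\<Sum>(w, a)\<in>?S. weight (w @ [a]))"
    by (rule sum.Sigma) (use fin finl in auto)
  also have "\<dots> = sum weight ?E"
    by (subst sum.reindex) (auto simp: inj_on_def o_def case_prod_unfold)
  also have "\<dots> \<le> sum weight (T l (Suc n) \<union> (\<Union>p\<in>{3..n}. ?B p))"
  proof (rule sum_mono2)
    show "finite (T l (Suc n) \<union> (\<Union>p\<in>{3..n}. ?B p))"
      using fin finE by simp
    show "?E \<subseteq> T l (Suc n) \<union> (\<Union>p\<in>{3..n}. ?B p)"
    proof
      fix x assume x: "x \<in> ?E"
      then obtain w a where wa: "w \<in> T l n" "a \<in> l (Suc n)" "short_square_free_ext w a"
        "x = w @ [a]" by auto
      show "x \<in> T l (Suc n) \<union> (\<Union>p\<in>{3..n}. ?B p)"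
      proof (cases "x \<in> T l (Suc n)")
        case False
        then obtain u where u: "u \<noteq> []" "suffix (u @ u) x" using wa snoc_in_T_Suc by metis
        have "length u \<ge> 3"
          using wa u unfolding short_square_free_ext_def by (force simp: not_le[symmetric])
        \<comment> \<open>This is relaxed to \<open>length u \<le> n\<close>, a simpler range that
          still suffices for the growth estimate.\<close>
        moreover have "length u + length u \<le> Suc n"
          using suffix_length_le[OF u(2)] wa by (simp add: T_def)
        ultimately have "length u \<in> {3..n}" by simp
        then show ?thesis using x u by blast
      qed simp
    qed
  qed (rule weight_nonneg)
  also have "\<dots> \<le> sum weight (T l (Suc n)) + sum weight (\<Union>p\<in>{3..n}. ?B p)"
    using fin finE by (simp add: sum_Un sum_nonneg weight_nonneg)
  also have "sum weight (\<Union>p\<in>{3..n}. ?B p) \<le> (\<Sum>p=3..n. sum weight (?B p))"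
    by (rule sum_UNION_le) (use finE weight_nonneg in auto)
  also have "\<dots> \<le> (\<Sum>p=3..n. sum weight (T l (Suc n - p)))"
    by (rule sum_mono, rule sum_weight_squares) (use fin in auto)
  finally show ?thesis by simp
qed

text \<open>By strong induction every earlier step grew by a factor 2.45, so the sum is at most
  \<open>W n\<close> times a geometric series.\<close>

lemma growth:
  fixes W :: "nat \<Rightarrow> real"
  assumes nonneg: "\<And>n. W n \<ge> 0"
    and rec: "\<And>n. 2.732 * W n \<le> W (Suc n) + (\<Sum>p=3..n. W (Suc n - p))"
  shows "2.45 * W n \<le> W (Suc n)"
proof (induction n rule: less_induct)
  case (less n)
  have pow: "2.45 ^ k * W (n - k) \<le> W n" if "k \<le> n" for k
    using that
  proof (induction k)
    case (Suc k)
    have "2.45 ^ Suc k * W (n - Suc k) = 2.45 ^ k * (2.45 * W (n - Suc k))" by simp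
    also have "\<dots> \<le> 2.45 ^ k * W (n - k)"
      using less.IH[of "n - Suc k"] Suc.prems by (intro mult_left_mono) (auto simp: Suc_diff_Suc)
    also have "\<dots> \<le> W n" using Suc by simp
    finally show ?case .
  qed simp
  \<comment> \<open>Here \<open>pow\<close> applies with \<open>k = p - 1\<close>, so the exponents
    start at 2.\<close>
  have "(\<Sum>p=3..n. W (Suc n - p)) \<le> (\<Sum>p=3..n. (1 / 2.45) ^ (p - 1) * W n)"
  proof (rule sum_mono)
    fix p assume "p \<in> {3..n}"
    then have "p - 1 \<le> n" "n - (p - 1) = Suc n - p" by auto
    then show "W (Suc n - p) \<le> (1 / 2.45) ^ (p - 1) * W n"
      using pow[of "p - 1"] by (simp add: field_simps power_divide)
  qed
  also have "\<dots> = (\<Sum>p=3..n. (1 / 2.45) ^ (p - 1)) * W n" by (simp add: sum_distrib_right)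
  \<comment> \<open>\<open>0.282 = 2.732 - 2.45\<close> is the loss that the recurrence can
    absorb.\<close>
  also have "\<dots> \<le> 0.282 * W n"
  proof (rule mult_right_mono)
    \<comment> \<open>Up to \<open>n + 2\<close> there are exactly \<open>n\<close> terms, so the
      closed form below holds for every \<open>n\<close>.\<close>
    have "(\<Sum>p=3..n. (1 / 2.45) ^ (p - 1)) \<le> (\<Sum>p=3..n+2. (1 / 2.45) ^ (p - 1) :: real)"
      by (rule sum_mono2) auto
    \<comment> \<open>\<open>400 / 1421 = 1 / (2.45 * 1.45)\<close> is the infinite geometric series
      with ratio \<open>1 / 2.45\<close> from exponent 2 on.\<close>
    also have "\<dots> = (400 / 1421) * (1 - (1 / 2.45) ^ n)"
      by (induction n) (simp_all add: algebra_simps)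
    also have "\<dots> \<le> 0.282" by (simp add: algebra_simps add_increasing2)
    finally show "(\<Sum>p=3..n. (1 / 2.45) ^ (p - 1)) \<le> (0.282 :: real)" .
  qed (rule nonneg)
  finally show ?case using rec[of n] by (simp add: algebra_simps)
qed

theorem theorem1:
  fixes l :: "nat \<Rightarrow> int set" and n :: nat
  assumes "\<And>i. i \<ge> 1 \<Longrightarrow> card (l i) = 4"
    and "n \<ge> 1"
  shows "real (card (T l n)) \<ge> 2.45 ^ n"
proof -
  \<comment> \<open>The total weight is a lower bound for the cardinality, and it starts at 1, the
    weight of the empty word.\<close>
  have "2.45 ^ n \<le> sum weight (T l n)"
  proof (induction n)
    case 0
    then show ?case by (simp add: T_0 weight_def ends_aba_def)
  next
    case (Suc n)
    have "2.45 * sum weight (T l n) \<le> sum weight (T l (Suc n))"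
      by (rule growth[of "\<lambda>n. sum weight (T l n)"])
        (use weight_recurrence[of l] assms(1) in \<open>auto intro: sum_nonneg weight_nonneg\<close>)
    then show ?case using Suc by simp
  qed
  also have "\<dots> \<le> (\<Sum>w\<in>T l n. 1)" by (rule sum_mono) (rule weight_le_1)
  finally show ?thesis by simp
qed

end
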